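(* Let $W$ be a set (of possible worlds) and let $\mathrm{ob}:\mathscr P(W)\to\mathscr P(\mathscr P(W))$ be a function satisfying the following three conditions, for all $X,Y,Z\subseteq W$: (5b) if $Y\cap X=Z\cap X$, then $Y\in\mathrm{ob}(X)$ if and only if $Z\in\mathrm{ob}(X)$; (5d) if $Y\subseteq X$, $Y\in\mathrm{ob}(X)$ and $X\subseteq Z$, then $(Z\setminus X)\cup Y\in\mathrm{ob}(Z)$; (5e) if $Y\subseteq X$, $Z\in\mathrm{ob}(X)$ and $Y\cap Z\neq\emptyset$, then $Z\in\mathrm{ob}(Y)$. Let $A,B$ be propositions whose truth sets $[\![A]\!],[\![B]\!]\subseteq W$ are mutually generic, i.e. the four sets $[\![A]\!]\cap[\![B]\!]$, $[\![A]\!]\setminus[\![B]\!]$, $[\![B]\!]\setminus[\![A]\!]$ and $W\setminus([\![A]\!]\cup[\![B]\!])$ are all nonempty. Then \[ [\![A]\!]\in\mathrm{ob}(W)\implies [\![B]\!]\in\mathrm{ob}(W\setminus[\![A]\!]). \]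
   Context: For a proposition $A$, $[\![A]\!]\subseteq W$ denotes the set of worlds in which $A$ is true; thus $[\![\top]\!]=W$ and $[\![\neg A]\!]=W\setminus[\![A]\!]$. The function $\mathrm{ob}$ assigns to each context $X\subseteq W$ the set of propositions (subsets of $W$) obligatory in that context. The conditions (5b), (5d), (5e) are Carmo and Jones' conditions 5(b), 5(d), 5(e). *)

theory Defs
  imports Main "HOL-Library.FuncSet"
begin

(* A proposition is a predicate on worlds, considered only on the carrier W. *)
definition truth_set :: "'w set \<Rightarrow> ('w \<Rightarrow> bool) \<Rightarrow> 'w set" where
  "truth_set W A = {w \<in> W. A w}"

(* Conditions 5(b), 5(d) and 5(e) of Carmo and Jones on ob, where Y : ob X reads
   "Y is obligatory in the context X". They constrain ob only on subsets of W. *)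

definition cj_5b :: "'w set \<Rightarrow> ('w set \<Rightarrow> 'w set set) \<Rightarrow> bool" where
  "cj_5b W ob \<longleftrightarrow>
    (\<forall>X Y Z. X \<subseteq> W \<longrightarrow> Y \<subseteq> W \<longrightarrow> Z \<subseteq> W \<longrightarrow>
      Y \<inter> X = Z \<inter> X \<longrightarrow> (Y \<in> ob X \<longleftrightarrow> Z \<in> ob X))"

definition cj_5d :: "'w set \<Rightarrow> ('w set \<Rightarrow> 'w set set) \<Rightarrow> bool" where
  "cj_5d W ob \<longleftrightarrow>
    (\<forall>X Y Z. X \<subseteq> W \<longrightarrow> Y \<subseteq> W \<longrightarrow> Z \<subseteq> W \<longrightarrow>
      Y \<subseteq> X \<longrightarrow> Y \<in> ob X \<longrightarrow> X \<subseteq> Z \<longrightarrow> (Z - X) \<union> Y \<in> ob Z)"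

definition cj_5e :: "'w set \<Rightarrow> ('w set \<Rightarrow> 'w set set) \<Rightarrow> bool" where
  "cj_5e W ob \<longleftrightarrow>
    (\<forall>X Y Z. X \<subseteq> W \<longrightarrow> Y \<subseteq> W \<longrightarrow> Z \<subseteq> W \<longrightarrow>
      Y \<subseteq> X \<longrightarrow> Z \<in> ob X \<longrightarrow> Y \<inter> Z \<noteq> {} \<longrightarrow> Z \<in> ob Y)"

definition mutually_generic :: "'w set \<Rightarrow> 'w set \<Rightarrow> 'w set \<Rightarrow> bool" where
  "mutually_generic W S T \<longleftrightarrow>
    S \<inter> T \<noteq> {} \<and> S - T \<noteq> {} \<and> T - S \<noteq> {} \<and> W - (S \<union> T) \<noteq> {}"

end

(* Restrict the obligation a to the context W - b, lift it back to W by 5(d), where it becomes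
   the obligation a \<union> b, and restrict that to the context W - a, where it agrees with b. *)

theory Submission
  imports Defs
begin

text \<open>With \<open>a\<close>, \<open>b\<close> the truth sets: lifting by 5(d) adds to an
  obligation all worlds outside its context, so the context \<open>W - b\<close> smuggles in an
  arbitrary \<open>b\<close> as a disjunct. In \<open>W - a\<close> the disjunct \<open>a\<close> is
  void and \<open>b\<close> remains. Genericity gives the overlaps that 5(e) asks for.\<close>

theorem theorem1:
  fixes W :: "'w set"
    and ob :: "'w set \<Rightarrow> 'w set set"
    and A B :: "'w \<Rightarrow> bool"
  assumes "ob \<in> Pow W \<rightarrow> Pow (Pow W)"
    and "cj_5b W ob"
    and "cj_5d W ob"
    and "cj_5e W ob"
    and "mutually_generic W (truth_set W A) (truth_set W B)"
  shows "truth_set W A \<in> ob W \<longrightarrow> truth_set W B \<in> ob (W - truth_set W A)"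
proof
  define a b where "a = truth_set W A" and "b = truth_set W B"
  have sub: "a \<subseteq> W" "b \<subseteq> W"
    by (auto simp: a_def b_def truth_set_def)
  have nonempty: "a - b \<noteq> {}" "b - a \<noteq> {}"
    using assms(5) by (auto simp: mutually_generic_def a_def b_def)
  have b5: "Z \<in> ob X" if "Y \<in> ob X" "Y \<inter> X = Z \<inter> X" "X \<subseteq> W" "Y \<subseteq> W" "Z \<subseteq> W" for X Y Z
    using assms(2) that unfolding cj_5b_def by blast
  have d5: "(Z - X) \<union> Y \<in> ob Z" if "Y \<in> ob X" "Y \<subseteq> X" "X \<subseteq> Z" "Z \<subseteq> W" for X Y Z
    using assms(3) that unfolding cj_5d_def by (meson order_trans)
  have e5: "Z \<in> ob Y" if "Z \<in> ob X" "Y \<subseteq> X" "Y \<inter> Z \<noteq> {}" "X \<subseteq> W" "Z \<subseteq> W" for X Y Z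
    using assms(4) that unfolding cj_5e_def by (meson order_trans)
  assume "truth_set W A \<in> ob W"
  then have "a \<in> ob W"
    by (simp add: a_def)
  \<comment> \<open>The overlap of \<open>a\<close> with the context \<open>W - b\<close> is
    \<open>a - b\<close>.\<close>
  then have "a \<in> ob (W - b)"
    by (rule e5) (use sub nonempty in auto)
  \<comment> \<open>5(d) lifts only obligations contained in their context, hence the trimming of
    \<open>a\<close>.\<close>
  then have "a - b \<in> ob (W - b)"
    by (rule b5) (use sub in auto)
  then have "(W - (W - b)) \<union> (a - b) \<in> ob W"
    by (rule d5) (use sub in auto)
  moreover have "(W - (W - b)) \<union> (a - b) = a \<union> b"
    using sub by auto
  ultimately have "a \<union> b \<in> ob W"
    by simp
  \<comment> \<open>Here the overlap is \<open>b - a\<close>.\<close>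
  then have "a \<union> b \<in> ob (W - a)"
    by (rule e5) (use sub nonempty in auto)
  then have "b \<in> ob (W - a)"
    by (rule b5) (use sub in auto)
  then show "truth_set W B \<in> ob (W - truth_set W A)"
    by (simp add: a_def b_def)
qed

end
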